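(* Let $n \geq 2$ be an integer. Then the monoid $\operatorname{End}(K_n)$ of endomorphisms of Kiselman's semigroup $K_n$ (under composition) is isomorphic, as a monoid, to the monoid $(D_n, \cdot)$ of $n \times n$ Boolean matrices that do not contain $\begin{pmatrix} 0 & 1 \\ 1 & 0 \end{pmatrix}$ as a $2\times 2$ submatrix, under Boolean matrix multiplication.
   Context: Kiselman's semigroup $K_n$ is the monoid (with unit element $e$) given by the monoid presentation $$K_n = \langle a_1, a_2, \dots, a_n \mid a_i^2 = a_i \ (1 \le i \le n), \; a_i a_j a_i = a_j a_i a_j = a_j a_i \ (1 \leq i < j \leq n) \rangle .$$ $\operatorname{End}(K_n)$ is the monoid of monoid endomorphisms of $K_n$ (so $e \mapsto e$), with operation $(\psi,\varphi) \mapsto \psi \circ \varphi$, where $(\psi\circ\varphi)(a) = \psi(\varphi(a))$. For a matrix $M$, $M_{i,j}$ denotes the entry in row $i$ and column $j$. A $2 \times 2$ matrix $A$ is a $2 \times 2$ submatrix of an $n \times n$ matrix $M$ if there exist columns $i < j$ and rows $x < y$ in $\{1, \dots, n\}$ (not necessarily consecutive) such that $$A = \begin{pmatrix} M_{x, i} & M_{x, j} \\ M_{y, i} & M_{y, j} \end{pmatrix}.$$ For $n \ge 2$, let $P = \begin{pmatrix} 0 & 1 \\ 1 & 0 \end{pmatrix}$ and $$D_n = \{ M \in \{0, 1\}^{n \times n} \mid P \text{ is not a } 2 \times 2 \text{ submatrix of } M \}.$$ The operation $\cdot$ on $D_n$ is Boolean matrix multiplication: $(A \cdot B)_{i, j}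 = \bigvee_{k=1}^n (A_{i, k} \land B_{k, j})$, where $\lor$ and $\land$ are the Boolean join and meet on $\{0,1\}$. $(D_n,\cdot)$ is a monoid whose unit is the identity matrix. *)

theory Defs
  imports "HOL-Algebra.Group" "Jordan_Normal_Form.Matrix"
begin

section \<open>Monoid presentations\<close>

text \<open>The congruence on the free monoid \<open>lists X\<close> generated by a set \<open>R\<close> of pairs of words.\<close>

inductive_set pres_cong :: "'a set \<Rightarrow> ('a list \<times> 'a list) set \<Rightarrow> ('a list \<times> 'a list) set"
  for X R where
  refl: "u \<in> lists X \<Longrightarrow> (u, u) \<in> pres_cong X R"
| sym: "(u, v) \<in> pres_cong X R \<Longrightarrow> (v, u) \<in> pres_cong X R"
| trans: "(u, v) \<in> pres_cong X R \<Longrightarrow> (v, w) \<in> pres_cong X R \<Longrightarrow> (u, w) \<in> pres_cong X R"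
| rel: "(u, v) \<in> R \<Longrightarrow> u \<in> lists X \<Longrightarrow> v \<in> lists X \<Longrightarrow> (u, v) \<in> pres_cong X R"
| mult: "(u, u') \<in> pres_cong X R \<Longrightarrow> (v, v') \<in> pres_cong X R \<Longrightarrow>
    (u @ v, u' @ v') \<in> pres_cong X R"

definition pres_monoid :: "'a set \<Rightarrow> ('a list \<times> 'a list) set \<Rightarrow> 'a list set monoid" where
  "pres_monoid X R = \<lparr>
     carrier = lists X // pres_cong X R,
     mult = (\<lambda>A B. \<Union>u\<in>A. \<Union>v\<in>B. pres_cong X R `` {u @ v}),
     one = pres_cong X R `` {[]}\<rparr>"

lemma pres_cong_lists:
  "(u, v) \<in> pres_cong X R \<Longrightarrow> u \<in> lists X \<and> v \<in> lists X"
  by (induction rule: pres_cong.induct) auto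

lemma equiv_pres_cong: "equiv (lists X) (pres_cong X R)"
proof (rule equivI)
  show "pres_cong X R \<subseteq> lists X \<times> lists X"
    by (auto dest: pres_cong_lists)
  show "refl_on (lists X) (pres_cong X R)"
    by (auto intro: refl_onI pres_cong.refl)
  show "Relation.sym (pres_cong X R)"
    by (auto intro: symI pres_cong.sym)
  show "Relation.trans (pres_cong X R)"
    by (auto intro: transI pres_cong.trans)
qed

lemma pres_monoid_mult:
  assumes "u \<in> lists X" "v \<in> lists X"
  shows "(pres_cong X R `` {u}) \<otimes>\<^bsub>pres_monoid X R\<^esub> (pres_cong X R `` {v}) =
    pres_cong X R `` {u @ v}"
proof -
  have eq: "pres_cong X R `` {u' @ v'} = pres_cong X R `` {u @ v}"
    if "(u, u') \<in> pres_cong X R" "(v, v') \<in> pres_cong X R" for u' v'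
    using equiv_class_eq[OF equiv_pres_cong pres_cong.mult[OF that]] by simp
  have "(\<Union>u'\<in>pres_cong X R `` {u}. \<Union>v'\<in>pres_cong X R `` {v}. pres_cong X R `` {u' @ v'}) =
      (\<Union>u'\<in>pres_cong X R `` {u}. \<Union>v'\<in>pres_cong X R `` {v}. pres_cong X R `` {u @ v})"
    by (intro SUP_cong refl eq) simp_all
  also have "\<dots> = pres_cong X R `` {u @ v}"
    using pres_cong.refl[OF assms(1), of R] pres_cong.refl[OF assms(2), of R] by blast
  finally show ?thesis
    by (simp only: pres_monoid_def monoid.simps partial_object.simps)
qed

lemma monoid_pres_monoid: "monoid (pres_monoid X R)"
proof -
  have car: "\<exists>u\<in>lists X. A = pres_cong X R `` {u}"
    if "A \<in> carrier (pres_monoid X R)" for A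
    using that by (auto simp: pres_monoid_def elim: quotientE)
  have cls: "pres_cong X R `` {u} \<in> carrier (pres_monoid X R)" if "u \<in> lists X" for u
    using that by (auto simp: pres_monoid_def intro: quotientI)
  have one: "\<one>\<^bsub>pres_monoid X R\<^esub> = pres_cong X R `` {[]}"
    by (simp add: pres_monoid_def)
  have app: "u @ v \<in> lists X" if "u \<in> lists X" "v \<in> lists X" for u v
    using that by simp
  have nil: "[] \<in> lists X" by simp
  show ?thesis
  proof
    fix x y assume "x \<in> carrier (pres_monoid X R)" "y \<in> carrier (pres_monoid X R)"
    then obtain u v where "u \<in> lists X" "v \<in> lists X"
      "x = pres_cong X R `` {u}" "y = pres_cong X R `` {v}"
      by (meson car)
    then show "x \<otimes>\<^bsub>pres_monoid X R\<^esub> y \<in> carrier (pres_monoid X R)"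
      by (simp only: pres_monoid_mult cls app)
  next
    fix x y z assume "x \<in> carrier (pres_monoid X R)" "y \<in> carrier (pres_monoid X R)"
      "z \<in> carrier (pres_monoid X R)"
    then obtain u v w where "u \<in> lists X" "v \<in> lists X" "w \<in> lists X"
      "x = pres_cong X R `` {u}" "y = pres_cong X R `` {v}" "z = pres_cong X R `` {w}"
      by (meson car)
    then show "x \<otimes>\<^bsub>pres_monoid X R\<^esub> y \<otimes>\<^bsub>pres_monoid X R\<^esub> z =
        x \<otimes>\<^bsub>pres_monoid X R\<^esub> (y \<otimes>\<^bsub>pres_monoid X R\<^esub> z)"
      by (simp only: pres_monoid_mult app append_assoc)
  next
    show "\<one>\<^bsub>pres_monoid X R\<^esub> \<in> carrier (pres_monoid X R)"
      unfolding one by (rule cls[OF nil])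
  next
    fix x assume "x \<in> carrier (pres_monoid X R)"
    then obtain u where "u \<in> lists X" "x = pres_cong X R `` {u}" by (meson car)
    then show "\<one>\<^bsub>pres_monoid X R\<^esub> \<otimes>\<^bsub>pres_monoid X R\<^esub> x = x"
      "x \<otimes>\<^bsub>pres_monoid X R\<^esub> \<one>\<^bsub>pres_monoid X R\<^esub> = x"
      by (simp_all only: one pres_monoid_mult nil append_Nil append_Nil2)
  qed
qed

section \<open>Kiselman's semigroup\<close>

text \<open>The letter \<open>i\<close> stands for the generator $a_i$.\<close>

definition kiselman_rels :: "nat \<Rightarrow> (nat list \<times> nat list) set" where
  "kiselman_rels n =
     {([i, i], [i]) | i. 1 \<le> i \<and> i \<le> n}
     \<union> {([i, j, i], [j, i, j]) | i j. 1 \<le> i \<and> i < j \<and> j \<le> n}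
     \<union> {([j, i, j], [j, i]) | i j. 1 \<le> i \<and> i < j \<and> j \<le> n}"

definition kiselman :: "nat \<Rightarrow> nat list set monoid" where
  "kiselman n = pres_monoid {1..n} (kiselman_rels n)"

section \<open>Endomorphism monoids\<close>

text \<open>A member of \<open>hom G G\<close> need not preserve the unit when \<open>G\<close> is only a monoid, so this is
  required separately. Extensionality makes equality of endomorphisms equality on the carrier.\<close>

definition End_monoid :: "('a, 'b) monoid_scheme \<Rightarrow> ('a \<Rightarrow> 'a) monoid" where
  "End_monoid G = \<lparr>
     carrier = {f \<in> hom G G \<inter> extensional (carrier G). f \<one>\<^bsub>G\<^esub> = \<one>\<^bsub>G\<^esub>},
     mult = (\<lambda>\<psi> \<phi>. compose (carrier G) \<psi> \<phi>),
     one = (\<lambda>x\<in>carrier G. x)\<rparr>"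

lemma monoid_End_monoid:
  assumes "monoid G"
  shows "monoid (End_monoid G)"
proof -
  interpret G: monoid G by fact
  let ?E = "End_monoid G"
  have car: "f \<in> carrier ?E \<longleftrightarrow>
      f \<in> hom G G \<and> f \<in> extensional (carrier G) \<and> f \<one>\<^bsub>G\<^esub> = \<one>\<^bsub>G\<^esub>" for f
    by (simp add: End_monoid_def)
  have mult: "f \<otimes>\<^bsub>?E\<^esub> g = compose (carrier G) f g" for f g
    by (simp add: End_monoid_def)
  have one: "\<one>\<^bsub>?E\<^esub> = (\<lambda>x\<in>carrier G. x)"
    by (simp add: End_monoid_def)
  have funcset: "f \<in> carrier G \<rightarrow> carrier G" if "f \<in> carrier ?E" for f
    using that by (simp add: car hom_def)
  show ?thesis
  proof
    fix x y assume x: "x \<in> carrier ?E" and y: "y \<in> carrier ?E"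
    have "compose (carrier G) x y \<in> hom G G"
    proof (rule homI)
      fix a assume a: "a \<in> carrier G"
      then show "compose (carrier G) x y a \<in> carrier G"
        using funcset_mem[OF funcset[OF x]] funcset_mem[OF funcset[OF y]]
        by (simp add: compose_eq)
      fix b assume b: "b \<in> carrier G"
      have "y a \<in> carrier G" "y b \<in> carrier G"
        using funcset_mem[OF funcset[OF y]] a b by blast+
      moreover have hom: "x \<in> hom G G" "y \<in> hom G G"
        using x y by (simp_all add: car)
      ultimately show "compose (carrier G) x y (a \<otimes>\<^bsub>G\<^esub> b) =
          compose (carrier G) x y a \<otimes>\<^bsub>G\<^esub> compose (carrier G) x y b"
        using a b by (simp add: compose_eq hom[THEN hom_mult])
    qed
    then show "x \<otimes>\<^bsub>?E\<^esub> y \<in> carrier ?E"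
      using x y by (simp add: car mult compose_eq)
  next
    show "\<one>\<^bsub>?E\<^esub> \<in> carrier ?E"
      by (simp add: car one hom_def)
  next
    fix x y z
    assume "z \<in> carrier ?E"
    then show "x \<otimes>\<^bsub>?E\<^esub> y \<otimes>\<^bsub>?E\<^esub> z = x \<otimes>\<^bsub>?E\<^esub> (y \<otimes>\<^bsub>?E\<^esub> z)"
      unfolding mult by (rule compose_assoc[OF funcset, symmetric])
  next
    fix x assume x: "x \<in> carrier ?E"
    then have "x \<in> extensional (carrier G)" by (simp add: car)
    with funcset[OF x] show "\<one>\<^bsub>?E\<^esub> \<otimes>\<^bsub>?E\<^esub> x = x" "x \<otimes>\<^bsub>?E\<^esub> \<one>\<^bsub>?E\<^esub> = x"
      unfolding mult one by (rule Id_compose, rule compose_Id)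
  qed
qed

section \<open>Boolean matrices avoiding a submatrix\<close>

text \<open>Boolean matrices are \<open>bool mat\<close>, with \<open>False\<close> for 0 and \<open>True\<close> for 1. Rows and columns of
  \<open>mat\<close> are numbered from 0, so entry $M_{i,j}$ is \<open>M $$ (i - 1, j - 1)\<close>. The library product
  \<open>*\<close> needs a semiring of entries, which \<open>bool\<close> is not.\<close>

definition bool_mat_mult :: "bool mat \<Rightarrow> bool mat \<Rightarrow> bool mat" where
  "bool_mat_mult A B =
     mat (dim_row A) (dim_col B) (\<lambda>(i, j). \<exists>k < dim_col A. A $$ (i, k) \<and> B $$ (k, j))"

definition is_submatrix2 :: "'a mat \<Rightarrow> 'a mat \<Rightarrow> bool" where
  "is_submatrix2 A M \<longleftrightarrow>
     (\<exists>i j x y. i < j \<and> j < dim_col M \<and> x < y \<and> y < dim_row M \<and>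
        A = mat_of_rows_list 2 [[M $$ (x, i), M $$ (x, j)],
                                [M $$ (y, i), M $$ (y, j)]])"

definition P_mat :: "bool mat" where
  "P_mat = mat_of_rows_list 2 [[False, True],
                               [True, False]]"

definition D_monoid :: "nat \<Rightarrow> bool mat monoid" where
  "D_monoid n = \<lparr>
     carrier = {M \<in> carrier_mat n n. \<not> is_submatrix2 P_mat M},
     mult = bool_mat_mult,
     one = mat n n (\<lambda>(i, j). i = j)\<rparr>"

lemma is_submatrix2_P_iff:
  "is_submatrix2 P_mat M \<longleftrightarrow>
     (\<exists>i j x y. i < j \<and> j < dim_col M \<and> x < y \<and> y < dim_row M \<and>
        \<not> M $$ (x, i) \<and> M $$ (x, j) \<and> M $$ (y, i) \<and> \<not> M $$ (y, j))"
proof -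
  have "mat_of_rows_list 2 [[a, b], [c, d]] = mat_of_rows_list 2 [[a', b'], [c', d']] \<longleftrightarrow>
      a = a' \<and> b = b' \<and> c = c' \<and> d = d'" for a b c d a' b' c' d' :: bool
  proof
    assume eq: "mat_of_rows_list 2 [[a, b], [c, d]] = mat_of_rows_list 2 [[a', b'], [c', d']]"
    have "mat_of_rows_list 2 [[a, b], [c, d]] $$ (i, j) =
        mat_of_rows_list 2 [[a', b'], [c', d']] $$ (i, j)" for i j
      by (simp only: eq)
    from this[of 0 0] this[of 0 1] this[of 1 0] this[of 1 1]
    show "a = a' \<and> b = b' \<and> c = c' \<and> d = d'"
      by (simp add: mat_of_rows_list_def)
  qed simp
  then show ?thesis
    unfolding is_submatrix2_def P_mat_def by auto
qed

lemma D_monoid_closed: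
  assumes A: "A \<in> carrier (D_monoid n)" and B: "B \<in> carrier (D_monoid n)"
  shows "bool_mat_mult A B \<in> carrier (D_monoid n)"
proof -
  have dim: "dim_row A = n" "dim_col A = n" "dim_row B = n" "dim_col B = n"
    using A B by (auto simp: D_monoid_def)
  have nAB: "\<not> is_submatrix2 P_mat A" "\<not> is_submatrix2 P_mat B"
    using A B by (auto simp: D_monoid_def)
  have noA: "A $$ (x, i) \<or> A $$ (y, j)"
    if "A $$ (x, j)" "A $$ (y, i)" "i < j" "j < n" "x < y" "y < n" for i j x y
    using nAB(1) that unfolding is_submatrix2_P_iff dim by blast
  have noB: "B $$ (x, i) \<or> B $$ (y, j)"
    if "B $$ (x, j)" "B $$ (y, i)" "i < j" "j < n" "x < y" "y < n" for i j x y
    using nAB(2) that unfolding is_submatrix2_P_iff dim by blast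
  have entry: "bool_mat_mult A B $$ (i, j) \<longleftrightarrow> (\<exists>k<n. A $$ (i, k) \<and> B $$ (k, j))"
    if "i < n" "j < n" for i j
    using that by (simp add: bool_mat_mult_def dim)
  have "\<not> is_submatrix2 P_mat (bool_mat_mult A B)"
  proof
    assume "is_submatrix2 P_mat (bool_mat_mult A B)"
    then obtain i j x y where ij: "i < j" "j < n" "x < y" "y < n"
      and e: "\<not> bool_mat_mult A B $$ (x, i)" "bool_mat_mult A B $$ (x, j)"
        "bool_mat_mult A B $$ (y, i)" "\<not> bool_mat_mult A B $$ (y, j)"
      unfolding is_submatrix2_P_iff by (auto simp: bool_mat_mult_def dim)
    have "i < n" "x < n" using ij by auto
    then obtain k l where kl: "k < n" "l < n" "A $$ (x, k)" "B $$ (k, j)" "A $$ (y, l)" "B $$ (l, i)"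
      using e ij entry by meson
    have z: "\<not> (A $$ (x, m) \<and> B $$ (m, i))" "\<not> (A $$ (y, m) \<and> B $$ (m, j))" if "m < n" for m
      using e ij entry that \<open>i < n\<close> \<open>x < n\<close> by meson+
    consider "k = l" | "k < l" | "l < k" by linarith
    then show False
    proof cases
      case 1
      then show False using z(1)[of k] kl by simp
    next
      case 2
      then show False using noB[where x=k and y=l and i=i and j=j] z(1)[of k] z(2)[of l] kl ij by blast
    next
      case 3
      then show False using noA[where x=x and y=y and i=l and j=k] z(1)[of l] z(2)[of k] kl ij by blast
    qed
  qed
  moreover have "bool_mat_mult A B \<in> carrier_mat n n"
    by (simp add: bool_mat_mult_def dim)
  ultimately show ?thesis
    by (simp add: D_monoid_def)
qed

lemma monoid_D_monoid: "monoid (D_monoid n)"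
proof -
  have mult: "A \<otimes>\<^bsub>D_monoid n\<^esub> B = bool_mat_mult A B" for A B
    by (simp add: D_monoid_def)
  have one: "\<one>\<^bsub>D_monoid n\<^esub> = mat n n (\<lambda>(i, j). i = j)"
    by (simp add: D_monoid_def)
  have dim: "dim_row A = n" "dim_col A = n" if "A \<in> carrier (D_monoid n)" for A
    using that by (auto simp: D_monoid_def)
  have dim_mult: "dim_row (bool_mat_mult A B) = dim_row A" "dim_col (bool_mat_mult A B) = dim_col B"
    for A B by (simp_all add: bool_mat_mult_def)
  have entry: "bool_mat_mult A B $$ (i, j) \<longleftrightarrow> (\<exists>k<dim_col A. A $$ (i, k) \<and> B $$ (k, j))"
    if "i < dim_row A" "j < dim_col B" for A B i j
    using that by (simp add: bool_mat_mult_def)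
  show ?thesis
  proof
    fix x y assume "x \<in> carrier (D_monoid n)" "y \<in> carrier (D_monoid n)"
    then show "x \<otimes>\<^bsub>D_monoid n\<^esub> y \<in> carrier (D_monoid n)"
      unfolding mult by (rule D_monoid_closed)
  next
    fix x y z
    assume "x \<in> carrier (D_monoid n)" "y \<in> carrier (D_monoid n)" "z \<in> carrier (D_monoid n)"
    note d = this[THEN dim(1)] this[THEN dim(2)]
    show "x \<otimes>\<^bsub>D_monoid n\<^esub> y \<otimes>\<^bsub>D_monoid n\<^esub> z = x \<otimes>\<^bsub>D_monoid n\<^esub> (y \<otimes>\<^bsub>D_monoid n\<^esub> z)"
      unfolding mult
    proof (rule eq_matI)
      fix i j
      assume "i < dim_row (bool_mat_mult x (bool_mat_mult y z))"
        "j < dim_col (bool_mat_mult x (bool_mat_mult y z))"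
      then have ij: "i < n" "j < n" by (simp_all add: dim_mult d)
      have "bool_mat_mult (bool_mat_mult x y) z $$ (i, j) \<longleftrightarrow>
          (\<exists>k<n. (\<exists>l<n. x $$ (i, l) \<and> y $$ (l, k)) \<and> z $$ (k, j))"
        using ij by (simp add: entry dim_mult d cong: conj_cong)
      moreover have "bool_mat_mult x (bool_mat_mult y z) $$ (i, j) \<longleftrightarrow>
          (\<exists>l<n. x $$ (i, l) \<and> (\<exists>k<n. y $$ (l, k) \<and> z $$ (k, j)))"
        using ij by (simp add: entry dim_mult d cong: conj_cong)
      ultimately show "bool_mat_mult (bool_mat_mult x y) z $$ (i, j) =
          bool_mat_mult x (bool_mat_mult y z) $$ (i, j)"
        by blast
    qed (simp_all add: dim_mult)
  next
    show "\<one>\<^bsub>D_monoid n\<^esub> \<in> carrier (D_monoid n)"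
      by (auto simp: D_monoid_def is_submatrix2_P_iff)
  next
    fix x assume "x \<in> carrier (D_monoid n)"
    note d = dim[OF this]
    show "\<one>\<^bsub>D_monoid n\<^esub> \<otimes>\<^bsub>D_monoid n\<^esub> x = x" "x \<otimes>\<^bsub>D_monoid n\<^esub> \<one>\<^bsub>D_monoid n\<^esub> = x"
      unfolding mult one
      by (rule eq_matI; simp add: entry dim_mult d cong: conj_cong)+
  qed
qed

end

theory Submission
  imports Defs "HOL-Library.Sublist"
begin

text \<open>For \<open>X \<subseteq> {1..n}\<close> let \<open>e_X\<close> be the product of the generators in \<open>X\<close> in decreasing order; it is
  the zero of the submonoid generated by \<open>X\<close>, and every idempotent of $K_n$ with content \<open>X\<close> equals
  \<open>e_X\<close>. Hence an endomorphism \<open>f\<close> is determined by the sets \<open>X i\<close> with \<open>f (a_i) = e_(X i)\<close>. For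
  \<open>i < j\<close> the defining relations force \<open>e_(X j) e_(X i)\<close> to be \<open>e_(X i \<union> X j)\<close>. This happens exactly
  when every element of \<open>X j - X i\<close> exceeds every element of \<open>X i - X j\<close>, which says that the matrix
  whose \<open>i\<close>-th column is the indicator of \<open>X i\<close> avoids the forbidden submatrix. With images as
  columns, composition of endomorphisms becomes the Boolean matrix product in the same order.\<close>

declare One_nat_def [simp del]

section \<open>Idempotents of Kiselman's semigroup\<close>

definition kcls :: "nat \<Rightarrow> nat list \<Rightarrow> nat list set" where
  "kcls n w = pres_cong {1..n} (kiselman_rels n) `` {w}"

lemma kcls_eq_iff:
  assumes "u \<in> lists {1..n}"
  shows "kcls n u = kcls n v \<longleftrightarrow> (u, v) \<in> pres_cong {1..n} (kiselman_rels n)"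
proof
  assume "kcls n u = kcls n v"
  then show "(u, v) \<in> pres_cong {1..n} (kiselman_rels n)"
    using pres_cong.refl[OF assms, of "kiselman_rels n"]
    unfolding kcls_def by (auto intro: pres_cong.sym)
next
  assume "(u, v) \<in> pres_cong {1..n} (kiselman_rels n)"
  then show "kcls n u = kcls n v"
    unfolding kcls_def by (rule equiv_class_eq[OF equiv_pres_cong])
qed

lemma kcls_eq_empty_iff: "kcls n w = {} \<longleftrightarrow> w \<notin> lists {1..n}"
proof
  show "w \<notin> lists {1..n}" if "kcls n w = {}"
    using that pres_cong.refl[of w "{1..n}" "kiselman_rels n"] by (auto simp: kcls_def)
  show "kcls n w = {}" if "w \<notin> lists {1..n}"
    using that pres_cong_lists[of w _ "{1..n}" "kiselman_rels n"] by (auto simp: kcls_def)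
qed

text \<open>A word with a letter outside \<open>{1..n}\<close> has an empty class, so equal classes
  agree on membership in \<open>lists {1..n}\<close>. This lets the rule hold for arbitrary
  words.\<close>

lemma kcls_append_cong:
  assumes "kcls n u = kcls n u'" "kcls n v = kcls n v'"
  shows "kcls n (u @ v) = kcls n (u' @ v')"
proof (cases "u \<in> lists {1..n} \<and> v \<in> lists {1..n}")
  case True
  then have "u @ v \<in> lists {1..n}" by simp
  then show ?thesis
    using assms True pres_cong.mult by (simp add: kcls_eq_iff)
next
  case False
  then have "u' \<notin> lists {1..n} \<or> v' \<notin> lists {1..n}"
    using kcls_eq_empty_iff[of n] assms by metis
  with False have "u @ v \<notin> lists {1..n}" "u' @ v' \<notin> lists {1..n}" by auto
  then have "kcls n (u @ v) = {}" "kcls n (u' @ v') = {}"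
    by (simp_all only: kcls_eq_empty_iff not_False_eq_True)
  then show ?thesis by simp
qed

lemma kcls_cong_right: "kcls n v = kcls n v' \<Longrightarrow> kcls n (u @ v) = kcls n (u @ v')"
  by (rule kcls_append_cong[OF HOL.refl])

lemma kcls_cong_left: "kcls n u = kcls n u' \<Longrightarrow> kcls n (u @ v) = kcls n (u' @ v)"
  by (rule kcls_append_cong[OF _ HOL.refl])

lemma kcls_idem:
  assumes "i \<in> {1..n}"
  shows "kcls n [i, i] = kcls n [i]"
  using assms by (subst kcls_eq_iff) (auto intro!: pres_cong.rel simp: kiselman_rels_def)

text \<open>The case \<open>i = j\<close> comes from idempotence; the weak inequality lets the
  deletion lemmas treat words in which the outer letter recurs.\<close>

lemma kcls_descent_right:
  assumes "i \<in> {1..n}" "j \<in> {1..n}" "i \<le> j"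
  shows "kcls n [j, i, j] = kcls n [j, i]"
proof (cases "i = j")
  case True
  then show ?thesis
    using kcls_cong_right[OF kcls_idem, of j n "[j]"] assms by simp
next
  case False
  with assms show ?thesis
    by (subst kcls_eq_iff) (auto intro!: pres_cong.rel simp: kiselman_rels_def)
qed

lemma kcls_descent_left:
  assumes "i \<in> {1..n}" "j \<in> {1..n}" "i \<le> j"
  shows "kcls n [i, j, i] = kcls n [j, i]"
proof (cases "i = j")
  case True
  then show ?thesis
    using kcls_cong_right[OF kcls_idem, of j n "[j]"] assms by simp
next
  case False
  with assms have "kcls n [i, j, i] = kcls n [j, i, j]"
    by (subst kcls_eq_iff) (auto intro!: pres_cong.rel simp: kiselman_rels_def)
  with kcls_descent_right[OF assms] show ?thesis by simp
qed

text \<open>Expanding the final \<open>j i\<close> to \<open>i j i\<close> plants a copy of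
  \<open>i\<close> directly after the shorter word. The induction hypothesis then removes the
  leading \<open>i\<close>, and the planted copy is contracted again.\<close>

lemma kcls_delete_first:
  assumes "i \<in> {1..n}" "set w \<subseteq> {i..n}"
  shows "kcls n (i # w @ [i]) = kcls n (w @ [i])"
  using assms(2)
proof (induction w rule: rev_induct)
  case Nil
  then show ?case using kcls_idem[OF assms(1)] by simp
next
  case (snoc j w)
  have j: "kcls n [i, j, i] = kcls n [j, i]"
    using snoc.prems assms(1) by (intro kcls_descent_left) auto
  have "kcls n (i # (w @ [j]) @ [i]) = kcls n ((i # w) @ [i, j, i])"
    using kcls_cong_right[OF j, of "i # w"] by simp
  also have "\<dots> = kcls n ((w @ [i]) @ [j, i])"
    using kcls_cong_left[OF snoc.IH, of "[j, i]"] snoc.prems by simp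
  also have "\<dots> = kcls n ((w @ [j]) @ [i])"
    using kcls_cong_right[OF j, of w] by simp
  finally show ?case .
qed

text \<open>Mirror image of \<open>kcls_delete_first\<close>: here \<open>j i\<close> is expanded to
  \<open>j i j\<close> at the front.\<close>

lemma kcls_delete_last:
  assumes "j \<in> {1..n}" "set w \<subseteq> {1..j}"
  shows "kcls n (j # w @ [j]) = kcls n (j # w)"
  using assms(2)
proof (induction w)
  case Nil
  then show ?case using kcls_idem[OF assms(1)] by simp
next
  case (Cons i w)
  have i: "kcls n [j, i, j] = kcls n [j, i]"
    using Cons.prems assms(1) by (intro kcls_descent_right) auto
  have "kcls n (j # (i # w) @ [j]) = kcls n ([j, i] @ (j # w @ [j]))"
    using kcls_cong_left[OF i, of "w @ [j]"] by simp
  also have "\<dots> = kcls n ([j, i] @ (j # w))"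
    using Cons by (intro kcls_cong_right) simp
  also have "\<dots> = kcls n (j # i # w)"
    using kcls_cong_left[OF i, of w] by simp
  finally show ?case .
qed

text \<open>Since \<open>u\<close> absorbs \<open>k\<close>, a copy of \<open>k\<close> can be
  inserted after \<open>u\<close>; it makes the trailing \<open>k\<close> redundant and is then
  absorbed itself.\<close>

lemma kcls_absorb_past_smaller:
  assumes "kcls n (u @ [k]) = kcls n u" "k \<in> {1..n}" "set w \<subseteq> {1..k}"
  shows "kcls n (u @ w @ [k]) = kcls n (u @ w)"
proof -
  have "kcls n (u @ w @ [k]) = kcls n (u @ k # w @ [k])"
    using kcls_cong_left[OF assms(1), of "w @ [k]"] by simp
  also have "\<dots> = kcls n (u @ k # w)"
    using assms by (intro kcls_cong_right kcls_delete_last)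
  also have "\<dots> = kcls n (u @ w)"
    using kcls_cong_left[OF assms(1), of w] by simp
  finally show ?thesis .
qed

lemma kcls_absorb_word:
  assumes "\<And>k. k \<in> set w \<Longrightarrow> kcls n (u @ [k]) = kcls n u"
  shows "kcls n (u @ w) = kcls n u"
  using assms
proof (induction w)
  case (Cons k w)
  have "kcls n (u @ k # w) = kcls n (u @ w)"
    using kcls_cong_left[OF Cons.prems[of k], of w] by simp
  with Cons show ?case by simp
qed simp

section \<open>The elements \<open>e_X\<close> as decreasing words\<close>

definition dec_word :: "nat set \<Rightarrow> nat list" where
  "dec_word X = rev (sorted_list_of_set X)"

lemma sorted_dec_word: "sorted_wrt (>) (dec_word X)"
  by (simp add: dec_word_def sorted_wrt_rev)

lemma set_dec_word [simp]: "X \<subseteq> {1..n} \<Longrightarrow> set (dec_word X) = X"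
  by (simp add: dec_word_def finite_subset[of X "{1..n}"])

lemma dec_word_in_lists: "X \<subseteq> {1..n} \<Longrightarrow> dec_word X \<in> lists {1..n}"
  using set_dec_word[of X n] by (auto simp: in_lists_conv_set)

text \<open>Decreasing order puts the letters around \<open>k\<close> exactly where
  \<open>kcls_delete_first\<close> and \<open>kcls_delete_last\<close> want them.\<close>

lemma dec_word_split:
  assumes "X \<subseteq> {1..n}" "k \<in> X"
  obtains U V where "dec_word X = U @ k # V" "set U \<subseteq> {k..n}" "set V \<subseteq> {1..k}"
proof -
  have "k \<in> set (dec_word X)" using assms by simp
  then obtain U V where eq: "dec_word X = U @ k # V" by (meson split_list)
  have "set U \<subseteq> X" "set V \<subseteq> X"
    using set_dec_word[OF assms(1)] unfolding eq by auto
  moreover have "\<forall>x\<in>set U. k < x" "\<forall>x\<in>set V. x < k"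
    using sorted_dec_word[of X] unfolding eq by (auto simp: sorted_wrt_append)
  ultimately show thesis
    using that[OF eq] assms(1) by fastforce
qed

lemma kcls_Cons_dec_word:
  assumes "X \<subseteq> {1..n}" "k \<in> X"
  shows "kcls n (k # dec_word X) = kcls n (dec_word X)"
proof -
  obtain U V where d: "dec_word X = U @ k # V" "set U \<subseteq> {k..n}" "set V \<subseteq> {1..k}"
    using dec_word_split[OF assms] .
  have "kcls n (k # U @ [k]) = kcls n (U @ [k])"
    using assms d by (intro kcls_delete_first) auto
  from kcls_cong_left[OF this, of V] show ?thesis by (simp add: d)
qed

lemma kcls_dec_word_snoc:
  assumes "X \<subseteq> {1..n}" "k \<in> X"
  shows "kcls n (dec_word X @ [k]) = kcls n (dec_word X)"
proof -
  obtain U V where d: "dec_word X = U @ k # V" "set U \<subseteq> {k..n}" "set V \<subseteq> {1..k}"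
    using dec_word_split[OF assms] .
  have "kcls n (k # V @ [k]) = kcls n (k # V)"
    using assms d by (intro kcls_delete_last) auto
  from kcls_cong_right[OF this, of U] show ?thesis by (simp add: d)
qed

lemma kcls_append_dec_word:
  assumes "X \<subseteq> {1..n}" "set w \<subseteq> X"
  shows "kcls n (w @ dec_word X) = kcls n (dec_word X)"
  using assms(2)
proof (induction w)
  case (Cons k w)
  have "kcls n ([k] @ w @ dec_word X) = kcls n ([k] @ dec_word X)"
    using Cons by (intro kcls_cong_right) auto
  also have "\<dots> = kcls n (dec_word X)"
    using kcls_Cons_dec_word[OF assms(1)] Cons.prems by simp
  finally show ?case by simp
qed simp

text \<open>The product of \<open>u\<close> and \<open>e_X\<close> is computed twice:
  \<open>u\<close> absorbs the letters of \<open>e_X\<close> on its right, and \<open>e_X\<close>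
  absorbs those of \<open>u\<close> on its left.\<close>

lemma kcls_eq_dec_wordI:
  assumes "X \<subseteq> {1..n}" "set u \<subseteq> X" "\<And>k. k \<in> X \<Longrightarrow> kcls n (u @ [k]) = kcls n u"
  shows "kcls n u = kcls n (dec_word X)"
proof -
  have "kcls n u = kcls n (u @ dec_word X)"
    using assms by (intro kcls_absorb_word[symmetric]) simp
  also have "\<dots> = kcls n (dec_word X)"
    by (rule kcls_append_dec_word[OF assms(1,2)])
  finally show ?thesis .
qed

text \<open>Going down from the largest letter, suppose \<open>u\<close> absorbs every letter above \<open>k\<close> on its right.
  Then all letters above \<open>k\<close> may be deleted from the second factor of \<open>u u\<close>, and what is left
  absorbs \<open>k\<close>.\<close>

lemma kcls_idempotent:
  assumes u: "set u \<subseteq> {1..n}" and idem: "kcls n (u @ u) = kcls n u"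
  shows "kcls n u = kcls n (dec_word (set u))"
proof (rule kcls_eq_dec_wordI[OF u subset_refl])
  fix k assume "k \<in> set u"
  then show "kcls n (u @ [k]) = kcls n u"
  proof (induction "n - k" arbitrary: k rule: less_induct)
    case less
    have IH: "kcls n (u @ [j]) = kcls n u" if "j \<in> set u" "k < j" for j
      using less.hyps[of j] that u by fastforce
    let ?f = "filter (\<lambda>x. x \<le> k)"
    have filt: "kcls n (u @ v) = kcls n (u @ ?f v)" if "set v \<subseteq> set u" for v
      using that
    proof (induction v rule: rev_induct)
      case (snoc j v)
      have *: "kcls n (u @ v @ [j]) = kcls n (u @ ?f v @ [j])"
        using kcls_cong_left[OF snoc.IH, of "[j]"] snoc.prems by simp
      show ?case
      proof (cases "j \<le> k")
        case False
        \<comment> \<open>The kept letters are at most \<open>k\<close>, hence below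
          \<open>j\<close>, so the absorption of \<open>j\<close> by \<open>u\<close> carries past
          them.\<close>
        have "set (?f v) \<subseteq> {1..j}" using False snoc.prems u by auto
        then have "kcls n (u @ ?f v @ [j]) = kcls n (u @ ?f v)"
          using False snoc.prems u IH[of j] by (intro kcls_absorb_past_smaller) auto
        with * False show ?thesis by simp
      qed (use * in simp)
    qed simp
    have "k \<in> set (?f u)" using less.prems by simp
    then obtain p q where pq: "?f u = p @ k # q" by (meson split_list)
    have "set q \<subseteq> set (?f u)" unfolding pq by auto
    then have "set q \<subseteq> {1..k}" using u by fastforce
    then have kq: "kcls n (k # q @ [k]) = kcls n (k # q)"
      using less.prems u by (intro kcls_delete_last) auto
    have "kcls n (u @ [k]) = kcls n ((u @ u) @ [k])"
      by (rule kcls_cong_left[OF idem[symmetric]])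
    also have "\<dots> = kcls n ((u @ ?f u) @ [k])"
      by (rule kcls_cong_left[OF filt[OF subset_refl]])
    also have "\<dots> = kcls n (u @ ?f u)"
      using kcls_cong_right[OF kq, of "u @ p"] by (simp add: pq)
    also have "\<dots> = kcls n u"
      using filt[OF subset_refl] idem by simp
    finally show ?case .
  qed
qed

lemma filter_split_sorted_desc:
  fixes xs :: "'a::linorder list"
  shows "sorted_wrt (>) xs \<Longrightarrow> filter (\<lambda>x. k < x) xs @ filter (\<lambda>x. x \<le> k) xs = xs"
proof (induction xs)
  case (Cons a xs)
  show ?case
  proof (cases "k < a")
    case True
    with Cons show ?thesis by simp
  next
    case False
    then have "filter (\<lambda>x. k < x) xs = []" "filter (\<lambda>x. x \<le> k) xs = xs"
      using Cons.prems by (auto simp: filter_empty_conv filter_id_conv)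
    with False show ?thesis by simp
  qed
qed simp

text \<open>It suffices that the product absorbs each letter \<open>k\<close> of the union on its
  right. If \<open>k\<close> is in \<open>Y\<close>, the second factor does it. Otherwise the
  letters of \<open>Y\<close> above \<open>k\<close> lie in \<open>X\<close> and vanish into the
  first factor, which then absorbs \<open>k\<close> past the remaining smaller letters.\<close>

lemma kcls_dec_word_append_dec_word:
  assumes X: "X \<subseteq> {1..n}" and Y: "Y \<subseteq> {1..n}"
    and XY: "\<And>x y. x \<in> X - Y \<Longrightarrow> y \<in> Y - X \<Longrightarrow> y < x"
  shows "kcls n (dec_word X @ dec_word Y) = kcls n (dec_word (X \<union> Y))"
proof (rule kcls_eq_dec_wordI)
  fix k assume k: "k \<in> X \<union> Y"
  show "kcls n ((dec_word X @ dec_word Y) @ [k]) = kcls n (dec_word X @ dec_word Y)"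
  proof (cases "k \<in> Y")
    case True
    from kcls_cong_right[OF kcls_dec_word_snoc[OF Y this], of "dec_word X"]
    show ?thesis by simp
  next
    case False
    with k have kX: "k \<in> X" by simp
    define U V where "U = filter (\<lambda>x. k < x) (dec_word Y)"
      and "V = filter (\<lambda>x. x \<le> k) (dec_word Y)"
    have Yeq: "dec_word Y = U @ V"
      unfolding U_def V_def by (simp add: filter_split_sorted_desc[OF sorted_dec_word])
    have "set U \<subseteq> X"
    proof
      fix y assume "y \<in> set U"
      then have "y \<in> Y" "k < y" using Y by (auto simp: U_def)
      then show "y \<in> X" using XY[of k y] kX False by force
    qed
    then have "kcls n (dec_word X @ [j]) = kcls n (dec_word X)" if "j \<in> set U" for j
      using that by (intro kcls_dec_word_snoc[OF X]) auto
    then have "kcls n (dec_word X @ U) = kcls n (dec_word X)"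
      by (rule kcls_absorb_word)
    note XU = kcls_cong_left[OF this]
    have "set V \<subseteq> {1..k}" using Y by (auto simp: V_def)
    then have "kcls n (dec_word X @ V @ [k]) = kcls n (dec_word X @ V)"
      using X kX by (intro kcls_absorb_past_smaller kcls_dec_word_snoc[OF X]) auto
    then show ?thesis
      using XU[of "V @ [k]"] XU[of V] by (simp add: Yeq)
  qed
qed (use X Y in auto)

section \<open>Invariants of words\<close>

lemma subseq_pair_set: "subseq [y, x] w \<Longrightarrow> y \<in> set w \<and> x \<in> set w"
  by (induction w) (auto simp: subseq_singleton_left split: if_splits)

text \<open>A pair straddling the cut depends only on the letter sets of the factors, which are
  invariant; hence the order of two letters can be followed through products.\<close>

lemma subseq_pair_append:
  "subseq [y, x] (u @ v) \<longleftrightarrow> subseq [y, x] u \<or> subseq [y, x] v \<or> y \<in> set u \<and> x \<in> set v"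
  by (induction u) (auto simp: subseq_singleton_left dest: subseq_pair_set)

lemma pres_cong_kiselman_set:
  "(u, v) \<in> pres_cong {1..n} (kiselman_rels n) \<Longrightarrow> set u = set v"
  by (induction rule: pres_cong.induct) (auto simp: kiselman_rels_def)

text \<open>The relation survives deletion of all letters but \<open>x\<close> and \<open>y\<close>, and the words in the class
  of \<open>[y, x]\<close> in the two-letter semigroup are those in which some \<open>y\<close> precedes some \<open>x\<close>.\<close>

lemma pres_cong_kiselman_subseq:
  assumes "(u, v) \<in> pres_cong {1..n} (kiselman_rels n)" "x < y"
  shows "subseq [y, x] u \<longleftrightarrow> subseq [y, x] v"
  using assms(1)
proof (induction rule: pres_cong.induct)
  case (rel u v)
  then show ?case
    using assms(2) by (auto simp: kiselman_rels_def split: if_splits)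
next
  case (mult u u' v v')
  then show ?case by (simp add: subseq_pair_append pres_cong_kiselman_set[of _ _ n])
qed auto

text \<open>If \<open>x < y\<close>, then \<open>y\<close> precedes \<open>x\<close> in the triple
  product, with \<open>y\<close> from the middle and \<open>x\<close> from the last factor. In the
  double product \<open>x\<close> occurs only in the first factor and \<open>y\<close> only in the
  second, which contradicts invariance.\<close>

lemma kcls_dec_word_absorb_imp_less:
  assumes X: "X \<subseteq> {1..n}" and Y: "Y \<subseteq> {1..n}"
    and eq: "kcls n (dec_word X @ dec_word Y @ dec_word X) = kcls n (dec_word X @ dec_word Y)"
    and x: "x \<in> X - Y" and y: "y \<in> Y - X"
  shows "y < x"
proof (rule ccontr)
  assume "\<not> y < x"
  with x y have "x < y" by (metis DiffD1 DiffD2 linorder_neqE_nat)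
  have "dec_word X @ dec_word Y @ dec_word X \<in> lists {1..n}"
    using X Y by (simp add: dec_word_in_lists)
  then have "subseq [y, x] (dec_word X @ dec_word Y @ dec_word X) \<longleftrightarrow>
      subseq [y, x] (dec_word X @ dec_word Y)"
    using pres_cong_kiselman_subseq[OF _ \<open>x < y\<close>] eq by (simp add: kcls_eq_iff)
  then show False
    using x y X Y by (auto simp: subseq_pair_append dest: subseq_pair_set)
qed

text \<open>The union avoids choosing a representative: all words of a class have the same
  letters.\<close>

definition content :: "'a list set \<Rightarrow> 'a set" where
  "content A = (\<Union>w\<in>A. set w)"

lemma content_kcls:
  assumes "w \<in> lists {1..n}"
  shows "content (kcls n w) = set w"
proof -
  have "kcls n w \<noteq> {}" using assms by (simp only: kcls_eq_empty_iff simp_thms)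
  moreover have "set v = set w" if "v \<in> kcls n w" for v
    using that by (intro pres_cong_kiselman_set[of w v n, symmetric]) (simp add: kcls_def)
  ultimately show ?thesis by (simp add: content_def)
qed

lemma carrier_kiselman: "carrier (kiselman n) = kcls n ` lists {1..n}"
  by (auto simp: kiselman_def pres_monoid_def kcls_def quotient_def)

lemma one_kiselman: "\<one>\<^bsub>kiselman n\<^esub> = kcls n []"
  by (simp add: kiselman_def pres_monoid_def kcls_def)

lemma mult_kiselman:
  "u \<in> lists {1..n} \<Longrightarrow> v \<in> lists {1..n} \<Longrightarrow>
    kcls n u \<otimes>\<^bsub>kiselman n\<^esub> kcls n v = kcls n (u @ v)"
  unfolding kiselman_def kcls_def by (rule pres_monoid_mult)

lemma kcls_in_carrier: "w \<in> lists {1..n} \<Longrightarrow> kcls n w \<in> carrier (kiselman n)"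
  by (simp add: carrier_kiselman)

section \<open>Endomorphisms and matrices\<close>

definition endo_sets :: "nat \<Rightarrow> (nat list set \<Rightarrow> nat list set) \<Rightarrow> nat \<Rightarrow> nat set" where
  "endo_sets n f i = content (f (kcls n [i]))"

text \<open>The endomorphism of the free monoid that lifts an endomorphism with \<open>a_i\<close>
  going to \<open>e_(S i)\<close>.\<close>

definition subst :: "(nat \<Rightarrow> nat set) \<Rightarrow> nat list \<Rightarrow> nat list" where
  "subst S w = concat (map (\<lambda>i. dec_word (S i)) w)"

lemma subst_simps [simp]:
  "subst S [] = []" "subst S (i # w) = dec_word (S i) @ subst S w"
  "subst S (u @ v) = subst S u @ subst S v"
  by (simp_all add: subst_def)

lemma set_subst:
  assumes "\<And>i. i \<in> {1..n} \<Longrightarrow> S i \<subseteq> {1..n}" "w \<in> lists {1..n}"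
  shows "set (subst S w) = (\<Union>i\<in>set w. S i)"
proof -
  have "set (dec_word (S i)) = S i" if "i \<in> set w" for i
  proof -
    from assms(2) that have "i \<in> {1..n}" by (auto simp: in_lists_conv_set)
    then show ?thesis by (rule set_dec_word[OF assms(1)])
  qed
  then show ?thesis by (simp add: subst_def)
qed

lemma subst_in_lists:
  assumes "\<And>i. i \<in> {1..n} \<Longrightarrow> S i \<subseteq> {1..n}" "w \<in> lists {1..n}"
  shows "subst S w \<in> lists {1..n}"
  using set_subst[OF assms] assms by (force simp: in_lists_conv_set)

text \<open>The image of an idempotent generator is idempotent, so \<open>kcls_idempotent\<close>
  applies to any word representing it.\<close>

lemma End_kiselman_generator:
  assumes f: "f \<in> carrier (End_monoid (kiselman n))" and i: "i \<in> {1..n}"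
  shows "endo_sets n f i \<subseteq> {1..n}" "f (kcls n [i]) = kcls n (dec_word (endo_sets n f i))"
proof -
  have hom: "f \<in> hom (kiselman n) (kiselman n)" using f by (simp add: End_monoid_def)
  have ci: "kcls n [i] \<in> carrier (kiselman n)" using i by (intro kcls_in_carrier) simp
  from hom_in_carrier[OF hom ci] obtain u where u: "u \<in> lists {1..n}" "f (kcls n [i]) = kcls n u"
    by (auto simp: carrier_kiselman)
  have S: "endo_sets n f i = set u" by (simp add: endo_sets_def u content_kcls)
  with u show "endo_sets n f i \<subseteq> {1..n}" by auto
  have "kcls n (u @ u) = f (kcls n [i] \<otimes>\<^bsub>kiselman n\<^esub> kcls n [i])"
    using hom_mult[OF hom ci ci] u by (simp add: mult_kiselman)
  also have "\<dots> = kcls n u"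
    using i u by (simp add: mult_kiselman kcls_idem)
  finally show "f (kcls n [i]) = kcls n (dec_word (endo_sets n f i))"
    unfolding S u(2) using u(1) by (intro kcls_idempotent) auto
qed

lemma End_kiselman_word:
  assumes f: "f \<in> carrier (End_monoid (kiselman n))" and w: "w \<in> lists {1..n}"
  shows "f (kcls n w) = kcls n (subst (endo_sets n f) w)"
  using w
proof (induction w)
  case Nil
  \<comment> \<open>This is where preservation of the unit enters.\<close>
  then show ?case using f by (simp add: End_monoid_def one_kiselman)
next
  case (Cons i w)
  have hom: "f \<in> hom (kiselman n) (kiselman n)" using f by (simp add: End_monoid_def)
  note S = End_kiselman_generator[OF f]
  have i: "i \<in> {1..n}" "[i] \<in> lists {1..n}" and w: "w \<in> lists {1..n}" using Cons by auto
  have "f (kcls n (i # w)) = f (kcls n [i] \<otimes>\<^bsub>kiselman n\<^esub> kcls n w)"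
    by (simp add: mult_kiselman[OF i(2) w])
  also have "\<dots> = f (kcls n [i]) \<otimes>\<^bsub>kiselman n\<^esub> f (kcls n w)"
    by (intro hom_mult[OF hom] kcls_in_carrier i w)
  also have "\<dots> = kcls n (dec_word (endo_sets n f i)) \<otimes>\<^bsub>kiselman n\<^esub>
      kcls n (subst (endo_sets n f) w)"
    by (simp only: S(2)[OF i(1)] Cons.IH)
  also have "\<dots> = kcls n (subst (endo_sets n f) (i # w))"
    using S(1) i w by (simp add: mult_kiselman dec_word_in_lists subst_in_lists
        del: atLeastAtMost_iff)
  finally show ?case .
qed

section \<open>Families of sets that arise from endomorphisms\<close>

definition crossing_free :: "nat \<Rightarrow> (nat \<Rightarrow> nat set) \<Rightarrow> bool" where
  "crossing_free n S \<longleftrightarrow> (\<forall>i\<in>{1..n}. S i \<subseteq> {1..n}) \<and>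
     (\<forall>i\<in>{1..n}. \<forall>j\<in>{1..n}. i < j \<longrightarrow> (\<forall>x\<in>S j - S i. \<forall>y\<in>S i - S j. y < x))"

lemma crossing_freeD:
  assumes "crossing_free n S" "i \<in> {1..n}"
  shows "S i \<subseteq> {1..n}"
    and "j \<in> {1..n} \<Longrightarrow> i < j \<Longrightarrow> x \<in> S j - S i \<Longrightarrow> y \<in> S i - S j \<Longrightarrow> y < x"
proof -
  show "S i \<subseteq> {1..n}" using assms by (simp add: crossing_free_def)
  assume "j \<in> {1..n}" "i < j"
  then have "\<forall>x\<in>S j - S i. \<forall>y\<in>S i - S j. y < x"
    using assms unfolding crossing_free_def by blast
  then show "x \<in> S j - S i \<Longrightarrow> y \<in> S i - S j \<Longrightarrow> y < x" by blast
qed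

text \<open>Applying \<open>f\<close> to the relation \<open>a_j a_i a_j = a_j a_i\<close> gives the
  hypothesis of \<open>kcls_dec_word_absorb_imp_less\<close>, with the set of \<open>j\<close> as
  \<open>X\<close> and that of \<open>i\<close> as \<open>Y\<close>.\<close>

lemma crossing_free_endo_sets:
  assumes f: "f \<in> carrier (End_monoid (kiselman n))"
  shows "crossing_free n (endo_sets n f)"
  unfolding crossing_free_def
proof (intro conjI ballI allI impI)
  show "endo_sets n f i \<subseteq> {1..n}" if "i \<in> {1..n}" for i
    by (rule End_kiselman_generator(1)[OF f that])
  fix i j x y assume i: "i \<in> {1..n}" and j: "j \<in> {1..n}" and "i < j"
    and xy: "x \<in> endo_sets n f j - endo_sets n f i" "y \<in> endo_sets n f i - endo_sets n f j"
  have "f (kcls n [j, i, j]) = f (kcls n [j, i])"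
    using kcls_descent_right[OF i j] \<open>i < j\<close> by simp
  then show "y < x"
    using i j xy
    by (intro kcls_dec_word_absorb_imp_less[of "endo_sets n f j" n "endo_sets n f i"]
        End_kiselman_generator(1)[OF f]) (simp_all add: End_kiselman_word[OF f])
qed

text \<open>For \<open>i < j\<close> the image of \<open>a_j a_i\<close> is
  \<open>e_(S i \<union> S j)\<close>, which absorbs the images of \<open>a_i\<close> and
  \<open>a_j\<close> on both sides. So all three sides of the defining relations get the same
  image.\<close>

lemma subst_pres_cong:
  assumes S: "crossing_free n S" and uv: "(u, v) \<in> pres_cong {1..n} (kiselman_rels n)"
  shows "kcls n (subst S u) = kcls n (subst S v)"
  using uv
proof (induction rule: pres_cong.induct)
  case (rel u v)
  have sub: "S i \<subseteq> {1..n}" if "i \<in> {1..n}" for i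
    by (rule crossing_freeD(1)[OF S that])
  let ?d = "\<lambda>i. dec_word (S i)"
  have absorb: "kcls n (?d i @ ?d j @ ?d i) = kcls n (?d j @ ?d i)"
    "kcls n (?d j @ ?d i @ ?d j) = kcls n (?d j @ ?d i)"
    if "i \<in> {1..n}" "j \<in> {1..n}" "i < j" for i j
  proof -
    have U: "S j \<union> S i \<subseteq> {1..n}" using sub that by simp
    have eq: "kcls n (?d j @ ?d i) = kcls n (dec_word (S j \<union> S i))"
      using crossing_freeD(2)[OF S] that by (intro kcls_dec_word_append_dec_word sub)
    have si: "set (?d i) = S i" "set (?d j) = S j"
      by (rule set_dec_word[OF sub], fact)+
    have "kcls n (?d i @ dec_word (S j \<union> S i)) = kcls n (dec_word (S j \<union> S i))"
      using si by (intro kcls_append_dec_word[OF U]) simp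
    then show "kcls n (?d i @ ?d j @ ?d i) = kcls n (?d j @ ?d i)"
      using kcls_cong_right[OF eq, of "?d i"] eq by simp
    have "kcls n (dec_word (S j \<union> S i) @ [k]) = kcls n (dec_word (S j \<union> S i))"
      if "k \<in> set (?d j)" for k
      using that si by (intro kcls_dec_word_snoc[OF U]) simp
    then have "kcls n (dec_word (S j \<union> S i) @ ?d j) = kcls n (dec_word (S j \<union> S i))"
      by (rule kcls_absorb_word)
    then show "kcls n (?d j @ ?d i @ ?d j) = kcls n (?d j @ ?d i)"
      using kcls_cong_left[OF eq, of "?d j"] eq by simp
  qed
  have idem: "kcls n (?d i @ ?d i) = kcls n (?d i)" if "i \<in> {1..n}" for i
    using sub[OF that] by (intro kcls_append_dec_word) simp_all
  from rel.hyps(1) show ?case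
    unfolding kiselman_rels_def using absorb idem by auto
next
  case (mult u u' v v')
  then show ?case by (simp, intro kcls_append_cong)
qed auto

text \<open>For crossing-free \<open>S\<close> the chosen representative is immaterial by
  \<open>subst_pres_cong\<close>. Restricting to the carrier provides the extensionality that
  \<open>End_monoid\<close> demands.\<close>

definition endo_of :: "nat \<Rightarrow> (nat \<Rightarrow> nat set) \<Rightarrow> nat list set \<Rightarrow> nat list set" where
  "endo_of n S = (\<lambda>A\<in>carrier (kiselman n). kcls n (subst S (SOME w. w \<in> A)))"

lemma endo_of_kcls:
  assumes S: "crossing_free n S" and w: "w \<in> lists {1..n}"
  shows "endo_of n S (kcls n w) = kcls n (subst S w)"
proof -
  have "kcls n w \<noteq> {}" using w by (simp only: kcls_eq_empty_iff simp_thms)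
  then have "(SOME v. v \<in> kcls n w) \<in> kcls n w" by (simp add: some_in_eq)
  then have "(w, SOME v. v \<in> kcls n w) \<in> pres_cong {1..n} (kiselman_rels n)"
    by (simp add: kcls_def)
  from subst_pres_cong[OF S this] show ?thesis
    using w by (simp add: endo_of_def kcls_in_carrier)
qed

lemma endo_of_in_End:
  assumes S: "crossing_free n S"
  shows "endo_of n S \<in> carrier (End_monoid (kiselman n))"
proof -
  have sub: "S i \<subseteq> {1..n}" if "i \<in> {1..n}" for i
    by (rule crossing_freeD(1)[OF S that])
  note L = subst_in_lists[OF sub]
  have "endo_of n S \<in> hom (kiselman n) (kiselman n)"
  proof (rule homI)
    fix A assume "A \<in> carrier (kiselman n)"
    then obtain u where u: "u \<in> lists {1..n}" "A = kcls n u"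
      unfolding carrier_kiselman by blast
    show "endo_of n S A \<in> carrier (kiselman n)"
      unfolding u(2) endo_of_kcls[OF S u(1)] by (rule kcls_in_carrier[OF L[OF _ u(1)]])
    fix B assume "B \<in> carrier (kiselman n)"
    then obtain v where v: "v \<in> lists {1..n}" "B = kcls n v"
      unfolding carrier_kiselman by blast
    have uv: "u @ v \<in> lists {1..n}" using u(1) v(1) by simp
    show "endo_of n S (A \<otimes>\<^bsub>kiselman n\<^esub> B) =
        endo_of n S A \<otimes>\<^bsub>kiselman n\<^esub> endo_of n S B"
      unfolding u(2) v(2) mult_kiselman[OF u(1) v(1)] endo_of_kcls[OF S uv]
        endo_of_kcls[OF S u(1)] endo_of_kcls[OF S v(1)]
      by (simp only: subst_simps mult_kiselman[OF L[OF _ u(1)] L[OF _ v(1)]])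
  qed
  moreover have "endo_of n S \<one>\<^bsub>kiselman n\<^esub> = \<one>\<^bsub>kiselman n\<^esub>"
    by (simp add: one_kiselman endo_of_kcls[OF S])
  ultimately show ?thesis
    by (simp add: End_monoid_def endo_of_def)
qed

lemma endo_sets_endo_of:
  assumes S: "crossing_free n S" and i: "i \<in> {1..n}"
  shows "endo_sets n (endo_of n S) i = S i"
proof -
  have "S i \<subseteq> {1..n}" by (rule crossing_freeD(1)[OF S i])
  moreover have "[i] \<in> lists {1..n}" using i by simp
  ultimately show ?thesis
    by (simp add: endo_sets_def endo_of_kcls[OF S] content_kcls dec_word_in_lists
        del: Cons_in_lists_iff atLeastAtMost_iff)
qed

text \<open>Contents forget the order of letters, so applying \<open>f\<close> letter by letter to
  the word for \<open>g (a_i)\<close> just unites sets. This is the Boolean product read on one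
  column.\<close>

lemma endo_sets_compose:
  assumes f: "f \<in> carrier (End_monoid (kiselman n))" and g: "g \<in> carrier (End_monoid (kiselman n))"
    and i: "i \<in> {1..n}"
  shows "endo_sets n (f \<otimes>\<^bsub>End_monoid (kiselman n)\<^esub> g) i =
    (\<Union>l\<in>endo_sets n g i. endo_sets n f l)"
proof -
  note S = End_kiselman_generator(1)[OF f] End_kiselman_generator(1)[OF g]
  note d = dec_word_in_lists[OF S(2)[OF i]]
  have "endo_sets n (f \<otimes>\<^bsub>End_monoid (kiselman n)\<^esub> g) i = content (f (g (kcls n [i])))"
    using i by (simp add: endo_sets_def End_monoid_def compose_eq kcls_in_carrier)
  also have "\<dots> = content (kcls n (subst (endo_sets n f) (dec_word (endo_sets n g i))))"
    using End_kiselman_generator(2)[OF g i] End_kiselman_word[OF f d] by simp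
  also have "\<dots> = (\<Union>l\<in>endo_sets n g i. endo_sets n f l)"
    by (simp only: content_kcls[OF subst_in_lists[OF S(1) d]] set_subst[OF S(1) d]
        set_dec_word[OF S(2)[OF i]])
  finally show ?thesis .
qed

section \<open>The matrix of an endomorphism\<close>

definition endo_mat :: "nat \<Rightarrow> (nat list set \<Rightarrow> nat list set) \<Rightarrow> bool mat" where
  "endo_mat n f = mat n n (\<lambda>(k, i). Suc k \<in> endo_sets n f (Suc i))"

text \<open>A forbidden submatrix in rows \<open>x < y\<close> would put the smaller letter only in
  the later column's set and the larger one only in the earlier column's set, against
  \<open>crossing_free\<close>.\<close>

lemma endo_mat_in_D:
  assumes "f \<in> carrier (End_monoid (kiselman n))"
  shows "endo_mat n f \<in> carrier (D_monoid n)"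
proof -
  have "\<not> is_submatrix2 P_mat (endo_mat n f)"
  proof
    assume "is_submatrix2 P_mat (endo_mat n f)"
    then obtain i j x y where *: "i < j" "j < n" "x < y" "y < n"
      "\<not> endo_mat n f $$ (x, i)" "endo_mat n f $$ (x, j)"
      "endo_mat n f $$ (y, i)" "\<not> endo_mat n f $$ (y, j)"
      unfolding is_submatrix2_P_iff by (auto simp: endo_mat_def)
    \<comment> \<open>Letters count from 1 and matrix indices from 0, hence the shifts by
      \<open>Suc\<close>.\<close>
    have "Suc y < Suc x"
      by (rule crossing_freeD(2)[OF crossing_free_endo_sets[OF assms], of "Suc i" "Suc j"])
        (use * in \<open>simp_all add: endo_mat_def\<close>)
    with \<open>x < y\<close> show False by simp
  qed
  then show ?thesis by (simp add: D_monoid_def endo_mat_def)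
qed

lemma endo_mat_mult:
  assumes f: "f \<in> carrier (End_monoid (kiselman n))" and g: "g \<in> carrier (End_monoid (kiselman n))"
  shows "endo_mat n (f \<otimes>\<^bsub>End_monoid (kiselman n)\<^esub> g) = bool_mat_mult (endo_mat n f) (endo_mat n g)"
proof (rule eq_matI)
  fix k i assume "k < dim_row (bool_mat_mult (endo_mat n f) (endo_mat n g))"
    "i < dim_col (bool_mat_mult (endo_mat n f) (endo_mat n g))"
  then have ki: "k < n" "i < n" by (simp_all add: bool_mat_mult_def endo_mat_def)
  then have i: "Suc i \<in> {1..n}" by simp
  have "(\<exists>l\<in>endo_sets n g (Suc i). Suc k \<in> endo_sets n f l) \<longleftrightarrow>
      (\<exists>l<n. Suc l \<in> endo_sets n g (Suc i) \<and> Suc k \<in> endo_sets n f (Suc l))"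
  proof -
    \<comment> \<open>Letters are positive, so each one is the successor of an index at which the
      matrix product is summed.\<close>
    have "l \<in> endo_sets n g (Suc i) \<Longrightarrow> \<exists>m<n. l = Suc m" for l
      using End_kiselman_generator(1)[OF g i] by (cases l) auto
    then show ?thesis by metis
  qed
  then show "endo_mat n (f \<otimes>\<^bsub>End_monoid (kiselman n)\<^esub> g) $$ (k, i) =
      bool_mat_mult (endo_mat n f) (endo_mat n g) $$ (k, i)"
    using ki by (auto simp: endo_mat_def bool_mat_mult_def endo_sets_compose[OF f g i])
qed (simp_all add: bool_mat_mult_def endo_mat_def)

lemma endo_mat_inj: "inj_on (endo_mat n) (carrier (End_monoid (kiselman n)))"
proof (rule inj_onI)
  fix f g assume f: "f \<in> carrier (End_monoid (kiselman n))"
    and g: "g \<in> carrier (End_monoid (kiselman n))" and eq: "endo_mat n f = endo_mat n g"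
  have S: "endo_sets n f i = endo_sets n g i" if i: "i \<in> {1..n}" for i
  proof -
    have "k \<in> endo_sets n f i \<longleftrightarrow> k \<in> endo_sets n g i" if "k \<in> {1..n}" for k
      using arg_cong[OF eq, of "\<lambda>M. M $$ (k - 1, i - 1)"] that i
      by (cases k; cases i) (simp_all add: endo_mat_def Suc_le_eq)
    then show ?thesis
      using End_kiselman_generator(1)[OF f i] End_kiselman_generator(1)[OF g i] by blast
  qed
  have "f A = g A" if A: "A \<in> carrier (kiselman n)" for A
  proof -
    obtain w where w: "w \<in> lists {1..n}" "A = kcls n w" using A by (auto simp: carrier_kiselman)
    have "subst (endo_sets n f) w = subst (endo_sets n g) w"
      using w(1) S unfolding subst_def by (intro arg_cong[of _ _ concat] map_cong) auto
    then show ?thesis by (simp add: w End_kiselman_word f g)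
  qed
  \<comment> \<open>Agreement outside the carrier comes from extensionality.\<close>
  then show "f = g"
    using f g by (intro extensionalityI[of _ "carrier (kiselman n)"]) (simp_all add: End_monoid_def)
qed

lemma endo_mat_surj:
  assumes M: "M \<in> carrier (D_monoid n)"
  shows "M \<in> endo_mat n ` carrier (End_monoid (kiselman n))"
proof -
  \<comment> \<open>The witness family reads the columns of \<open>M\<close>.\<close>
  define S where "S i = {k \<in> {1..n}. M $$ (k - 1, i - 1)}" for i
  have dim: "dim_row M = n" "dim_col M = n" and noP: "\<not> is_submatrix2 P_mat M"
    using M by (auto simp: D_monoid_def)
  have S: "crossing_free n S"
    unfolding crossing_free_def
  proof (intro conjI ballI allI impI)
    fix i j x y assume *: "i \<in> {1..n}" "j \<in> {1..n}" "i < j" "x \<in> S j - S i" "y \<in> S i - S j"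
    show "y < x"
    proof (rule ccontr)
      assume "\<not> y < x"
      \<comment> \<open>Being distinct and positive, the letters stay strictly ordered after the
        shift to matrix indices.\<close>
      moreover have "x \<noteq> y" using * by auto
      ultimately have "x - 1 < y - 1" "y - 1 < n" "i - 1 < j - 1" "j - 1 < n"
        using * by (auto simp: S_def)
      moreover have "\<not> M $$ (x - 1, i - 1)" "M $$ (x - 1, j - 1)"
        "M $$ (y - 1, i - 1)" "\<not> M $$ (y - 1, j - 1)"
        using * by (auto simp: S_def)
      ultimately show False
        using noP unfolding is_submatrix2_P_iff dim by blast
    qed
  qed (auto simp: S_def)
  have "M = endo_mat n (endo_of n S)"
    by (rule eq_matI) (simp_all add: endo_mat_def dim endo_sets_endo_of[OF S], simp add: S_def)
  then show ?thesis using endo_of_in_End[OF S] by blast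
qed

lemma endo_mat_one: "endo_mat n \<one>\<^bsub>End_monoid (kiselman n)\<^esub> = \<one>\<^bsub>D_monoid n\<^esub>"
proof (rule eq_matI)
  fix k i assume "k < dim_row \<one>\<^bsub>D_monoid n\<^esub>" "i < dim_col \<one>\<^bsub>D_monoid n\<^esub>"
  then have ki: "k < n" "i < n" by (simp_all add: D_monoid_def)
  then have "endo_sets n \<one>\<^bsub>End_monoid (kiselman n)\<^esub> (Suc i) = {Suc i}"
    by (simp add: endo_sets_def End_monoid_def kcls_in_carrier content_kcls)
  with ki show "endo_mat n \<one>\<^bsub>End_monoid (kiselman n)\<^esub> $$ (k, i) = \<one>\<^bsub>D_monoid n\<^esub> $$ (k, i)"
    by (auto simp: endo_mat_def D_monoid_def)
qed (simp_all add: endo_mat_def D_monoid_def)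

theorem theorem1:
  fixes n :: nat
  assumes "n \<ge> 2"
  shows "\<exists>h \<in> iso (End_monoid (kiselman n)) (D_monoid n).
           h \<one>\<^bsub>End_monoid (kiselman n)\<^esub> = \<one>\<^bsub>D_monoid n\<^esub>"
proof (rule bexI)
  have "endo_mat n \<in> hom (End_monoid (kiselman n)) (D_monoid n)"
    by (rule homI) (simp_all add: endo_mat_in_D endo_mat_mult, simp add: D_monoid_def)
  moreover have "bij_betw (endo_mat n) (carrier (End_monoid (kiselman n))) (carrier (D_monoid n))"
    unfolding bij_betw_def using endo_mat_inj endo_mat_surj endo_mat_in_D by blast
  ultimately show "endo_mat n \<in> iso (End_monoid (kiselman n)) (D_monoid n)"
    by (simp add: iso_def)
qed (rule endo_mat_one)

end
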